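(* Let $\Psi$ be an orthonormal basis for $\mathbb{R}^N$ (an $N\times N$ orthogonal matrix), and let $1\le K<N$. Then: 1. Let $\Phi$ be an $M\times N$ random matrix with i.i.d. Gaussian entries, with $M\ge 2K$. Then, with probability one over $\Phi$, all signals $x=\Psi\vartheta$ with $\vartheta\in\mathbb{R}^N$, $\|\vartheta\|_0=K$, can be recovered uniquely from $y=\Phi x\in\mathbb{R}^M$ via $\ell_0$-norm minimization; that is, with probability one, for every such $\vartheta$, $\vartheta$ is the unique solution of $\min \|\vartheta'\|_0$ subject to $y=\Phi\Psi\vartheta'$. 2. Let $x=\Psi\vartheta$ be a signal with $\|\vartheta\|_0=K$. Let $\Phi$ be an $M\times N$ random matrix with i.i.d. Gaussian entries, independent of $x$, with $M\ge K+1$. Then, with probability one over $\Phi$, $x$ can be recovered uniquely from $y=\Phi x$ via $\ell_0$-norm minimization; that is, $\vartheta$ is the unique solution of $\min \|\vartheta'\|_0$ subject to $y=\Phi\Psi\vartheta'$. 3. Let $\Phi$ be an (arbitrary) $M\times N$ matrix with $M\le K$, and let $x=\Psi\vartheta$ with $\|\vartheta\|_0=K$. Then $x$ cannot be uniquely recovered from $y=\Phi x$, i.e., there exists $\vartheta'\ne\vartheta$ with $\|\vartheta'\|_0\le K$ and $\Phi\Psi\vartheta'=y$, except in the following pathological case: $M=K$, there is exactly one set $\Omega\subseteq\{1,\dots,N\}$ of $K$ indices for which the corresponding $K$ columns of $\Phi\Psi$ are linearly independent, and the set of nonzero indices of $\vartheta$ equals $\Omega$.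
   Context: $\|v\|_0$ denotes the number of nonzero entries of a vector $v$. Gaussian entries are zero-mean with positive variance. *)

theory Defs
  imports "HOL-Probability.Probability"
begin

definition support :: "real ^ 'n \<Rightarrow> 'n::finite set" where
  "support v = {i. v $ i \<noteq> 0}"

definition l0_norm :: "real ^ 'n::finite \<Rightarrow> nat" where
  "l0_norm v = card (support v)"

definition unique_l0_solution ::
  "real ^ 'n ^ 'm \<Rightarrow> real ^ 'm \<Rightarrow> real ^ 'n::finite \<Rightarrow> bool" where
  "unique_l0_solution A y v \<longleftrightarrow>
     {w. is_arg_min l0_norm (\<lambda>w. y = A *v w) w} = {v}"

text \<open>Independence of the indexed family of columns: \<open>independent\<close> alone speaks about the
  set of column vectors and would overlook repeated columns, hence the injectivity condition.\<close>

definition independent_columns :: "real ^ 'n ^ 'm \<Rightarrow> 'n::finite set \<Rightarrow> bool" where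
  "independent_columns A \<Omega> \<longleftrightarrow>
     inj_on (\<lambda>j. column j A) \<Omega> \<and> independent ((\<lambda>j. column j A) ` \<Omega>)"

text \<open>Here \<open>\<sigma>\<close> is the standard deviation; it is common to all entries, so
  that they are identically distributed.\<close>

definition iid_gaussian_matrix ::
  "'w measure \<Rightarrow> ('w \<Rightarrow> real ^ 'n::finite ^ 'm::finite) \<Rightarrow> bool" where
  "iid_gaussian_matrix P \<Phi> \<longleftrightarrow>
     prob_space.indep_vars P (\<lambda>_. borel) (\<lambda>(i, j) \<omega>. \<Phi> \<omega> $ i $ j) UNIV \<and>
     (\<exists>\<sigma>>0. \<forall>i j. distributed P lborel (\<lambda>\<omega>. \<Phi> \<omega> $ i $ j) (normal_density 0 \<sigma>))"

text \<open>The library's \<open>indep_var\<close> requires both random variables to have the same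
  type; this is the same notion for values in possibly different spaces.\<close>

definition independent_random_vectors ::
  "'w measure \<Rightarrow> ('w \<Rightarrow> 'a::topological_space) \<Rightarrow> ('w \<Rightarrow> 'b::topological_space) \<Rightarrow> bool" where
  "independent_random_vectors P X Y \<longleftrightarrow>
     X \<in> borel_measurable P \<and> Y \<in> borel_measurable P \<and>
     prob_space.indep_set P
       {X -` A \<inter> space P | A. A \<in> sets borel} {Y -` B \<inter> space P | B. B \<in> sets borel}"

end

theory Submission imports Defs begin

text \<open>A function on \<open>\<real>\<^sup>k\<close> that is affine in each coordinate and not identically zero vanishes only
  on a null set of an atomless product measure, by induction on \<open>k\<close> and Fubini. Applied to a
  determinant in the entries of \<open>\<Phi>\<close> this shows that, almost surely, \<open>\<Phi>\<close> is injective on any fixed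
  subspace of dimension at most \<open>M\<close>. If \<open>M \<ge> 2K\<close>, the finitely many coordinate subspaces of dimension
  at most \<open>2K\<close> contain every difference of two \<open>K\<close>-sparse vectors. If only \<open>M \<ge> K + 1\<close>, one first
  conditions on the signal \<open>\<theta>\<close> and uses, for each \<open>T\<close> of size at most \<open>K\<close> not containing the support
  of \<open>\<theta>\<close>, the span of \<open>\<theta>\<close> and the unit vectors indexed by \<open>T\<close>. If \<open>M \<le> K\<close>, either the columns
  indexed by the support of \<open>\<theta>\<close> are dependent, and a kernel vector can be added to \<open>\<theta>\<close>, or \<open>M = K\<close> and
  any other set of \<open>K\<close> independent columns spans \<open>\<real>\<^sup>M\<close>, hence represents the same measurement.\<close>

section \<open>Zero sets of multi-affine functions under product measures\<close>

text \<open>Being affine in a coordinate is expressed as interpolation between the values at 0 and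
  1, so the induction needs only two slices. The point \<open>x0\<close> must be extensional because
  for empty \<open>I\<close> the product space consists of the single function that is
  \<open>undefined\<close> everywhere.\<close>

lemma AE_PiM_multi_affine_nonzero:
  fixes f :: "('i \<Rightarrow> real) \<Rightarrow> real" and M :: "'i \<Rightarrow> real measure"
  assumes "finite I"
    and prob: "\<And>i. i \<in> I \<Longrightarrow> prob_space (M i)"
    and sets: "\<And>i. i \<in> I \<Longrightarrow> sets (M i) = sets borel"
    and atomless: "\<And>i a. i \<in> I \<Longrightarrow> AE t in M i. t \<noteq> a"
    and "f \<in> borel_measurable (PiM I M)"
    and "\<And>i x t. i \<in> I \<Longrightarrow> f (x(i := t)) = (1 - t) * f (x(i := 0)) + t * f (x(i := 1))"
    and "x0 \<in> extensional I" and "f x0 \<noteq> 0"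
  shows "AE x in PiM I M. f x \<noteq> 0"
  using assms
proof (induction I arbitrary: f x0 rule: finite_induct)
  case empty
  then have "f (\<lambda>_. undefined) \<noteq> 0" by simp
  then show ?case unfolding PiM_empty AE_count_space by simp
next
  case (insert i I)
  define g where "g c x = f (x(i := c))" for c x
  interpret Mi: prob_space "M i" using insert.prems(1) by simp
  have PiI: "prob_space (PiM I M)" by (rule prob_space_PiM) (simp add: insert.prems(1))
  interpret PI: prob_space "PiM I M" by (rule PiI)
  interpret pr: pair_sigma_finite "M i" "PiM I M" ..
  note sets_i[measurable_cong] = insert.prems(2)[OF insertI1]
  note f_meas[measurable] = insert.prems(4)
  have space_i: "space (M i) = UNIV"
    using sets_eq_imp_space_eq[OF sets_i] by simp
  have upd[measurable]: "(\<lambda>z. (snd z)(i := fst z)) \<in> M i \<Otimes>\<^sub>M PiM I M \<rightarrow>\<^sub>M PiM (insert i I) M"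
    by measurable
  have line: "f (x(i := t)) = (1 - t) * g 0 x + t * g 1 x" for x t
    unfolding g_def by (rule insert.prems(5)) simp
  \<comment> \<open>Resetting coordinate \<open>i\<close> of \<open>x0\<close> to
    \<open>undefined\<close> yields a point that is extensional on \<open>I\<close>, as the
    induction hypothesis for the slice requires.\<close>
  have g_AE: "AE x in PiM I M. g c x \<noteq> 0" if "g c (x0(i := undefined)) \<noteq> 0" for c
  proof (rule insert.IH)
    have "(\<lambda>x. x(i := c)) \<in> PiM I M \<rightarrow>\<^sub>M PiM (insert i I) M"
      by (rule measurable_fun_upd[where J=I]) (auto simp: space_i)
    then show "g c \<in> borel_measurable (PiM I M)"
      unfolding g_def by measurable
  next
    fix k x t assume "k \<in> I"
    then have "k \<noteq> i" using insert.hyps by auto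
    then have "x(k := s, i := c) = x(i := c, k := s)" for s
      by (rule fun_upd_twist)
    then show "g c (x(k := t)) = (1 - t) * g c (x(k := 0)) + t * g c (x(k := 1))"
      unfolding g_def using insert.prems(5)[of k "x(i := c)" t] \<open>k \<in> I\<close>
      by (simp only: insertI2)
  qed (use insert.prems that in \<open>auto simp: extensional_def\<close>)
  \<comment> \<open>Interpolation at \<open>x0 i\<close> recovers \<open>f x0\<close>, so the two
    slices cannot both vanish at the reset point.\<close>
  have "f x0 = (1 - x0 i) * g 0 (x0(i := undefined)) + x0 i * g 1 (x0(i := undefined))"
    using line[of "x0(i := undefined)" "x0 i"] by simp
  with insert.prems(7) have "g 0 (x0(i := undefined)) \<noteq> 0 \<or> g 1 (x0(i := undefined)) \<noteq> 0"
    by auto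
  then have "AE x in PiM I M. g 0 x \<noteq> 0 \<or> g 1 x \<noteq> 0"
    using g_AE[of 0] g_AE[of 1] by (auto elim!: eventually_mono)
  \<comment> \<open>A nonzero affine function of \<open>t\<close> has at most one root, the quotient
    below. If the denominator is 0 there is no root at all, and excluding the quotient is
    harmless.\<close>
  moreover have "AE t in M i. f (x(i := t)) \<noteq> 0" if "g 0 x \<noteq> 0 \<or> g 1 x \<noteq> 0" for x
    using insert.prems(3)[OF insertI1, of "g 0 x / (g 0 x - g 1 x)"]
  proof (rule AE_mp, intro AE_I2 impI notI)
    fix t assume "t \<noteq> g 0 x / (g 0 x - g 1 x)" "f (x(i := t)) = 0"
    with line[of x t] have *: "t * (g 0 x - g 1 x) = g 0 x" by (simp add: algebra_simps)
    with that have "g 0 x - g 1 x \<noteq> 0" by auto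
    with * have "t = g 0 x / (g 0 x - g 1 x)" by (simp add: field_simps)
    then show False using \<open>t \<noteq> _\<close> by simp
  qed
  ultimately have "AE x in PiM I M. AE t in M i. f (x(i := t)) \<noteq> 0"
    by (auto elim!: eventually_mono)
  \<comment> \<open>Fubini: the quantifiers are swapped so that the new coordinate comes first, as
    in the product measure used next.\<close>
  then have "AE t in M i. AE x in PiM I M. f (x(i := t)) \<noteq> 0"
    by (subst pr.AE_commute) auto
  then have "AE z in M i \<Otimes>\<^sub>M PiM I M. f ((snd z)(i := fst z)) \<noteq> 0"
    by (intro pr.AE_pair_measure) auto
  then have "AE x in distr (M i \<Otimes>\<^sub>M PiM I M) (PiM (insert i I) M) (\<lambda>(t, x). x(i := t)). f x \<noteq> 0"
    by (subst AE_distr_iff) (auto simp: case_prod_beta')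
  then show ?case
    by (subst (asm) distr_pair_PiM_eq_PiM) (use insert.prems in auto)
qed

section \<open>Padded determinants of Gaussian matrices\<close>

text \<open>This is linearity of the determinant in row \<open>k\<close>. It is applied to a change
  of one entry of the random matrix, which moves a single row of its product with a fixed
  matrix.\<close>

lemma det_affine_row:
  fixes A B C :: "real ^ 'n::finite ^ 'n"
  assumes k: "A $ k = s *s B $ k + t *s C $ k"
    and "\<And>i. i \<noteq> k \<Longrightarrow> B $ i = A $ i" and "\<And>i. i \<noteq> k \<Longrightarrow> C $ i = A $ i"
  shows "det A = s * det B + t * det C"
proof -
  have A: "A = (\<chi> i. if i = k then s *s B $ k + t *s C $ k else A $ i)"
    and B: "B = (\<chi> i. if i = k then B $ k else A $ i)"
    and C: "C = (\<chi> i. if i = k then C $ k else A $ i)"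
    using assms by (auto simp: vec_eq_iff)
  have "det A = det (\<chi> i. if i = k then s *s B $ k else A $ i)
              + det (\<chi> i. if i = k then t *s C $ k else A $ i)"
    by (subst A, rule det_row_add)
  also have "\<dots> = s * det (\<chi> i. if i = k then B $ k else A $ i)
                + t * det (\<chi> i. if i = k then C $ k else A $ i)"
    by (simp only: det_row_mul)
  finally show ?thesis
    using B C by simp
qed

text \<open>Replacing the columns outside \<open>R\<close> by unit vectors expresses the independence of
  the columns in \<open>R\<close> through a single determinant, which is multi-affine in the entries.\<close>

definition pad_columns :: "'m set \<Rightarrow> real ^ 'm ^ 'm \<Rightarrow> real ^ 'm ^ 'm" where
  "pad_columns R B = (\<chi> i j. if j \<in> R then B $ i $ j else if i = j then 1 else 0)"

text \<open>A vector supported in \<open>R\<close> does not see the padding, so \<open>B\<close>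
  acts on it like the invertible padded matrix.\<close>

lemma det_pad_columns_imp_ker_trivial:
  fixes B :: "real ^ 'm::finite ^ 'm"
  assumes "det (pad_columns R B) \<noteq> 0" "support z \<subseteq> R" "B *v z = 0"
  shows "z = 0"
proof -
  have "B *v z = pad_columns R B *v z"
    unfolding matrix_vector_mult_def pad_columns_def vec_eq_iff
    using assms(2) by (auto simp: support_def intro!: sum.cong)
  moreover have "\<exists>C. C ** pad_columns R B = mat 1"
    using assms(1) by (auto simp: invertible_det_nz[symmetric] invertible_def)
  ultimately show ?thesis
    using assms(3) matrix_left_invertible_ker by metis
qed

lemma subspace_support_subset: "subspace {z. support z \<subseteq> R}"
  by (auto simp: subspace_def support_def subset_iff) (metis add.right_neutral)

text \<open>The matrix \<open>A\<close> serves as the point where the padded determinant, as a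
  function of the entries, is nonzero. It is a linear left inverse of \<open>V\<close> on the
  vectors supported in \<open>R\<close>: the columns of \<open>A ** V\<close> in \<open>R\<close>
  are then unit vectors, and padding completes them to the identity.\<close>

lemma ex_left_inverse_on_support:
  fixes V :: "real ^ 'm::finite ^ 'n::finite"
  assumes "\<And>z. support z \<subseteq> R \<Longrightarrow> V *v z = 0 \<Longrightarrow> z = 0"
  obtains A :: "real ^ 'n ^ 'm" where "pad_columns R (A ** V) = mat 1"
proof -
  have "inj_on ((*v) V) {z. support z \<subseteq> R}"
  proof (rule inj_onI)
    fix y z assume "y \<in> {z. support z \<subseteq> R}" "z \<in> {z. support z \<subseteq> R}" "V *v y = V *v z"
    then have "y - z = 0"
      by (intro assms) (use subspace_diff[OF subspace_support_subset[of R], of y z] in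
          \<open>auto simp: matrix_vector_mult_diff_distrib\<close>)
    then show "y = z" by simp
  qed
  then obtain g where g: "linear g" "\<And>z. support z \<subseteq> R \<Longrightarrow> g (V *v z) = z"
    using linear_exists_left_inverse_on[OF matrix_vector_mul_linear subspace_support_subset, of V R]
    by auto
  have "(matrix g ** V) $ i $ j = (if i = j then 1 else 0)" if "j \<in> R" for i j
  proof -
    have "(matrix g ** V) *v axis j 1 = axis j 1"
      using g that by (simp add: matrix_works linear_matrix_vector_mul_eq
          matrix_vector_mul_assoc[symmetric] support_def axis_def subset_iff)
    then have "((matrix g ** V) *v axis j 1) $ i = axis j 1 $ i" by simp
    then show ?thesis
      by (simp add: matrix_vector_mult_basis column_def) (simp add: axis_def)
  qed
  then have "pad_columns R (matrix g ** V) = mat 1"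
    by (simp add: pad_columns_def mat_def vec_eq_iff)
  then show thesis by (rule that)
qed

lemma borel_measurable_det_pad_columns:
  fixes f :: "'a \<Rightarrow> real ^ 'm::finite ^ 'm"
  assumes [measurable]: "\<And>i j. (\<lambda>z. f z $ i $ j) \<in> borel_measurable N"
  shows "(\<lambda>z. det (pad_columns R (f z))) \<in> borel_measurable N"
proof -
  have "(\<lambda>z. pad_columns R (f z) $ i $ j) \<in> borel_measurable N" for i j
    by (simp add: pad_columns_def)
  then show ?thesis
    unfolding det_def by measurable
qed

text \<open>The determinant is multi-affine in the entries of the random matrix and nonzero at the
  left inverse of \<open>V\<close>. Independence makes the joint law of the entries a product of
  Gaussian laws, which have no atoms.\<close>

lemma AE_iid_gaussian_det_pad_columns_nonzero:
  fixes \<Phi> :: "'w \<Rightarrow> real ^ 'n::finite ^ 'm::finite" and V :: "real ^ 'm ^ 'n"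
  assumes "prob_space P" and "iid_gaussian_matrix P \<Phi>"
    and ker: "\<And>z. support z \<subseteq> R \<Longrightarrow> V *v z = 0 \<Longrightarrow> z = 0"
  shows "AE \<omega> in P. det (pad_columns R (\<Phi> \<omega> ** V)) \<noteq> 0"
proof -
  interpret prob_space P by fact
  define X where "X = (\<lambda>(i, j) \<omega>. \<Phi> \<omega> $ i $ j)"
  define mat_of :: "('m \<times> 'n \<Rightarrow> real) \<Rightarrow> real ^ 'n ^ 'm" where "mat_of x = (\<chi> i j. x (i, j))" for x
  define f where "f x = det (pad_columns R (mat_of x ** V))" for x
  let ?M = "\<lambda>p. distr P borel (X p)"
  from assms(2) obtain \<sigma> where indep: "indep_vars (\<lambda>_. borel) X UNIV"
    and \<sigma>: "\<And>p. distributed P lborel (X p) (normal_density 0 \<sigma>)"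
    unfolding iid_gaussian_matrix_def X_def by auto
  have rv[measurable]: "X p \<in> borel_measurable P" for p
    using \<sigma>[of p] by (simp add: distributed_def)
  have f_meas: "f \<in> borel_measurable (PiM UNIV ?M)"
    unfolding f_def mat_of_def
    by (intro borel_measurable_det_pad_columns) (simp add: matrix_matrix_mult_def)
  have "AE x in PiM UNIV ?M. f x \<noteq> 0"
  proof -
    obtain A where A: "pad_columns R (A ** V) = mat 1"
      using ex_left_inverse_on_support ker by blast
    have "mat_of (\<lambda>(i, j). A $ i $ j) = A"
      by (simp add: mat_of_def vec_eq_iff)
    with A have wit: "f (\<lambda>(i, j). A $ i $ j) \<noteq> 0"
      by (simp add: f_def det_I)
    show ?thesis
    proof (rule AE_PiM_multi_affine_nonzero[OF _ _ _ _ f_meas _ _ wit])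
      show "prob_space (?M p)" for p
        by (rule prob_space_distr) simp
      show "AE t in ?M p. t \<noteq> a" for p a
      proof -
        have eq: "?M p = density lborel (normal_density 0 \<sigma>)"
          using \<sigma>[of p] by (simp add: distributed_def cong: distr_cong)
        show ?thesis
          unfolding eq by (subst AE_density) (auto intro: AE_mp[OF AE_lborel_singleton[of a]])
      qed
      fix p :: "'m \<times> 'n" and x t
      obtain k l where p: "p = (k, l)" by fastforce
      \<comment> \<open>The entry \<open>p = (k, l)\<close> enters only row \<open>k\<close> of the
        product, and does so affinely. Constant padding entries are also compatible, since the
        weights \<open>1 - t\<close> and \<open>t\<close> add up to 1.\<close>
      have *: "(mat_of (x(p := t)) ** V) $ k $ c = (1 - t) * (mat_of (x(p := 0)) ** V) $ k $ c
          + t * (mat_of (x(p := 1)) ** V) $ k $ c" for c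
        unfolding matrix_matrix_mult_def mat_of_def
        by (simp add: sum_distrib_left sum.distrib[symmetric])
          (rule sum.cong, auto simp: p algebra_simps)
      show "f (x(p := t)) = (1 - t) * f (x(p := 0)) + t * f (x(p := 1))"
        unfolding f_def
      proof (rule det_affine_row[where k = k])
        show "pad_columns R (mat_of (x(p := t)) ** V) $ k =
            (1 - t) *s pad_columns R (mat_of (x(p := 0)) ** V) $ k +
            t *s pad_columns R (mat_of (x(p := 1)) ** V) $ k"
          unfolding vec_eq_iff using * by (simp add: pad_columns_def algebra_simps)
      qed (auto simp: pad_columns_def mat_of_def matrix_matrix_mult_def vec_eq_iff p)
    qed auto
  qed
  moreover have "PiM UNIV ?M = distr P (PiM UNIV (\<lambda>_. borel)) (\<lambda>\<omega>. \<lambda>p\<in>UNIV. X p \<omega>)"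
    using indep_vars_iff_distr_eq_PiM[THEN iffD1, OF _ _ indep] rv by auto
  ultimately have "AE x in distr P (PiM UNIV (\<lambda>_. borel)) (\<lambda>\<omega>. \<lambda>p\<in>UNIV. X p \<omega>). f x \<noteq> 0"
    by (simp only:)
  then have "AE \<omega> in P. f (\<lambda>p\<in>UNIV. X p \<omega>) \<noteq> 0"
    by (rule AE_distrD[rotated]) simp
  moreover have "mat_of (\<lambda>p\<in>UNIV. X p \<omega>) = \<Phi> \<omega>" for \<omega>
    by (simp add: mat_of_def X_def vec_eq_iff restrict_def)
  ultimately show ?thesis
    by (simp add: f_def)
qed

section \<open>Deterministic part: sparse solutions and too few measurements\<close>

lemma unique_l0_solutionI:
  assumes "y = A *v v"
    and "\<And>w. l0_norm w \<le> l0_norm v \<Longrightarrow> A *v w = y \<Longrightarrow> w = v"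
  shows "unique_l0_solution A y v"
proof -
  have "l0_norm v < l0_norm w" if "y = A *v w" "w \<noteq> v" for w
    using assms(2)[of w] that by (metis not_le)
  with assms(1) show ?thesis
    unfolding unique_l0_solution_def is_arg_min_def by (auto dest: order.asym)
qed

text \<open>If the columns are distinct, the coefficients of a linear relation form the kernel
  vector; if two coincide, the difference of their unit vectors does.\<close>

lemma ex_ker_vector_of_dependent_columns:
  fixes A :: "real ^ 'n::finite ^ 'm::finite"
  assumes "\<not> independent_columns A S"
  obtains z where "z \<noteq> 0" "support z \<subseteq> S" "A *v z = 0"
proof (cases "inj_on (\<lambda>j. column j A) S")
  case True
  with assms have "dependent ((\<lambda>j. column j A) ` S)"
    by (simp add: independent_columns_def)
  then obtain u where u: "\<exists>j\<in>S. u (column j A) \<noteq> 0" "(\<Sum>j\<in>S. u (column j A) *\<^sub>R column j A) = 0"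
    by (auto simp: dependent_finite sum.reindex[OF True])
  define z where "z = (\<chi> j. if j \<in> S then u (column j A) else 0)"
  have "A *v z = (\<Sum>j\<in>S. u (column j A) *\<^sub>R column j A)"
    unfolding matrix_mult_sum scalar_mult_eq_scaleR
    by (rule sum.mono_neutral_cong_right) (auto simp: z_def)
  with u show thesis
    by (intro that[of z]) (auto simp: z_def support_def vec_eq_iff)
next
  case False
  then obtain j k where jk: "j \<in> S" "k \<in> S" "j \<noteq> k" "column j A = column k A"
    by (auto simp: inj_on_def)
  let ?z = "axis j 1 - axis k 1 :: real ^ 'n"
  have "?z $ j \<noteq> 0"
    using jk by (simp add: axis_def)
  then have "?z \<noteq> 0" by (metis zero_index)
  moreover have "support ?z \<subseteq> S"
    using jk by (auto simp: support_def axis_def split: if_splits)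
  moreover have "A *v ?z = 0"
    using jk by (simp add: matrix_vector_mult_diff_distrib matrix_vector_mult_basis)
  ultimately show thesis by (rule that)
qed

text \<open>As many independent vectors as the dimension of the target span it, and the coefficients
  of \<open>y\<close> give \<open>z\<close>.\<close>

lemma ex_supported_preimage_of_independent_columns:
  fixes A :: "real ^ 'n::finite ^ 'm::finite"
  assumes "independent_columns A S" and "card S = CARD('m)"
  obtains z where "support z \<subseteq> S" "A *v z = y"
proof -
  let ?c = "\<lambda>j. column j A"
  have inj: "inj_on ?c S" and ind: "independent (?c ` S)"
    using assms(1) by (auto simp: independent_columns_def)
  have "UNIV \<subseteq> span (?c ` S)"
    by (rule card_ge_dim_independent) (use ind inj assms(2) in \<open>auto simp: card_image\<close>)
  then obtain u where u: "y = (\<Sum>j\<in>S. u (?c j) *\<^sub>R ?c j)"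
    by (auto simp: span_finite sum.reindex[OF inj])
  define z where "z = (\<chi> j. if j \<in> S then u (?c j) else 0)"
  have "A *v z = y"
    unfolding u matrix_mult_sum scalar_mult_eq_scaleR
    by (rule sum.mono_neutral_cong_right) (auto simp: z_def)
  then show thesis
    by (intro that[of z]) (auto simp: z_def support_def split: if_splits)
qed

lemma ex_other_sparse_preimage:
  fixes A :: "real ^ 'n::finite ^ 'm::finite"
  assumes m: "CARD('m) \<le> l0_norm \<theta>"
    and nonpath: "\<not> (CARD('m) = l0_norm \<theta> \<and>
      {S. card S = l0_norm \<theta> \<and> independent_columns A S} = {support \<theta>})"
  obtains \<theta>' where "\<theta>' \<noteq> \<theta>" "l0_norm \<theta>' \<le> l0_norm \<theta>" "A *v \<theta>' = A *v \<theta>"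
proof (cases "independent_columns A (support \<theta>)")
  case False
  then obtain z where z: "z \<noteq> 0" "support z \<subseteq> support \<theta>" "A *v z = 0"
    by (rule ex_ker_vector_of_dependent_columns)
  have "support (\<theta> + z) \<subseteq> support \<theta>"
    using z(2) by (auto simp: support_def)
  then show thesis
    using z(1,3) by (intro that[of "\<theta> + z"])
      (auto simp: l0_norm_def matrix_vector_right_distrib intro: card_mono)
next
  case True
  then have "card (support \<theta>) \<le> CARD('m)"
    using independent_bound[of "(\<lambda>j. column j A) ` support \<theta>"]
    by (auto simp: independent_columns_def card_image)
  with m have eq: "CARD('m) = l0_norm \<theta>"
    by (simp add: l0_norm_def)
  \<comment> \<open>The support of \<open>\<theta>\<close> is itself an admissible index set, so the
    failure of uniqueness supplies a different one.\<close>
  with True nonpath obtain S where S: "card S = l0_norm \<theta>" "independent_columns A S" "S \<noteq> support \<theta>"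
    by (auto simp: l0_norm_def)
  with eq obtain z where z: "support z \<subseteq> S" "A *v z = A *v \<theta>"
    using ex_supported_preimage_of_independent_columns by metis
  \<comment> \<open>Equality would put the support of \<open>\<theta>\<close> inside
    \<open>S\<close>, and equal cardinalities would make the two sets coincide.\<close>
  have "z \<noteq> \<theta>"
    using z(1) S(1,3) by (metis card_subset_eq finite l0_norm_def)
  moreover have "l0_norm z \<le> l0_norm \<theta>"
    using card_mono[OF _ z(1)] S(1) by (simp add: l0_norm_def)
  ultimately show thesis using z(2) that by blast
qed

section \<open>Almost sure injectivity on coordinate subspaces\<close>

lemma orthogonal_matrix_mult_eq_0D:
  assumes "orthogonal_matrix \<Psi>" and "\<Psi> *v x = 0"
  shows "x = 0"
  using assms by (metis orthogonal_matrix_def matrix_vector_mul_assoc matrix_vector_mul_lid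
      matrix_vector_mult_0_right)

text \<open>For \<open>e\<close> injective on \<open>T\<close>, this parametrises the coordinate
  subspace of \<open>T\<close> by vectors indexed by the rows of \<open>\<Phi>\<close>. The product
  with \<open>\<Phi> ** \<Psi>\<close> becomes square, so that determinants apply.\<close>

definition embedding_matrix :: "('n \<Rightarrow> 'm) \<Rightarrow> 'n set \<Rightarrow> real ^ 'm ^ 'n" where
  "embedding_matrix e T = (\<chi> j l. if j \<in> T \<and> l = e j then 1 else 0)"

lemma embedding_matrix_mult_nth:
  "(embedding_matrix e T *v u) $ j = (if j \<in> T then u $ e j else 0)"
  for e :: "'n::finite \<Rightarrow> 'm::finite"
  by (simp add: embedding_matrix_def matrix_vector_mult_def if_distrib[of "\<lambda>c. c * _"] sum.delta
      cong: if_cong)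

lemma embedding_matrix_ker_trivial:
  fixes e :: "'n::finite \<Rightarrow> 'm::finite"
  assumes "support u \<subseteq> e ` T" and "embedding_matrix e T *v u = 0"
  shows "u = 0"
proof -
  have "u $ e j = 0" if "j \<in> T" for j
    using that assms(2) embedding_matrix_mult_nth[of e T u j] by simp
  with assms(1) show ?thesis
    by (auto simp: vec_eq_iff support_def)
qed

lemma embedding_matrix_onto_support:
  fixes e :: "'n::finite \<Rightarrow> 'm::finite"
  assumes "inj_on e T" and "support z \<subseteq> T"
  obtains u where "support u \<subseteq> e ` T" "embedding_matrix e T *v u = z"
proof
  let ?u = "\<chi> l. if l \<in> e ` T then z $ inv_into T e l else 0"
  show "support ?u \<subseteq> e ` T"
    by (auto simp: support_def)
  show "embedding_matrix e T *v ?u = z"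
    using assms by (auto simp: vec_eq_iff embedding_matrix_mult_nth support_def)
qed

text \<open>Since \<open>card T\<close> is at most the number of rows, \<open>T\<close> injects into
  the row indices. Orthogonality of \<open>\<Psi>\<close> keeps the embedded coordinate subspace
  free of kernel, so the padded determinant is almost surely nonzero.\<close>

lemma AE_iid_gaussian_ker_trivial:
  fixes \<Phi> :: "'w \<Rightarrow> real ^ 'n::finite ^ 'm::finite" and \<Psi> :: "real ^ 'n ^ 'n"
  assumes "prob_space P" "iid_gaussian_matrix P \<Phi>" "orthogonal_matrix \<Psi>" "card T \<le> CARD('m)"
  shows "AE \<omega> in P. \<forall>z. support z \<subseteq> T \<longrightarrow> (\<Phi> \<omega> ** \<Psi>) *v z = 0 \<longrightarrow> z = 0"
proof -
  obtain e :: "'n \<Rightarrow> 'm" where e: "inj_on e T"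
    using card_le_inj[of T "UNIV :: 'm set"] assms(4) by auto
  let ?V = "\<Psi> ** embedding_matrix e T"
  have "AE \<omega> in P. det (pad_columns (e ` T) (\<Phi> \<omega> ** ?V)) \<noteq> 0"
    using assms(1,2)
  proof (rule AE_iid_gaussian_det_pad_columns_nonzero)
    fix u assume u: "support u \<subseteq> e ` T" "?V *v u = 0"
    then have "embedding_matrix e T *v u = 0"
      using orthogonal_matrix_mult_eq_0D[OF assms(3)] by (simp add: matrix_vector_mul_assoc[symmetric])
    with u(1) show "u = 0" by (rule embedding_matrix_ker_trivial)
  qed
  then show ?thesis
  proof (rule eventually_mono, intro allI impI)
    fix \<omega> z
    assume det: "det (pad_columns (e ` T) (\<Phi> \<omega> ** ?V)) \<noteq> 0"
      and z: "support z \<subseteq> T" "(\<Phi> \<omega> ** \<Psi>) *v z = 0"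
    obtain u where u: "support u \<subseteq> e ` T" "embedding_matrix e T *v u = z"
      using embedding_matrix_onto_support[OF e z(1)] .
    have "(\<Phi> \<omega> ** ?V) *v u = 0"
      using z(2) u(2) by (simp add: matrix_vector_mul_assoc[symmetric])
    with det u show "z = 0"
      using det_pad_columns_imp_ker_trivial by fastforce
  qed
qed

section \<open>Random signals independent of the matrix\<close>

text \<open>Independence makes the joint law of \<open>X\<close> and \<open>Y\<close> the product of
  their laws. Fubini then passes from each fixed \<open>y\<close> to the random value of
  \<open>Y\<close>; the exceptional null set may depend on \<open>y\<close>, which is why
  \<open>Q\<close> must be jointly measurable.\<close>

lemma AE_independent_random_vectors:
  fixes X :: "'w \<Rightarrow> 'a::topological_space" and Y :: "'w \<Rightarrow> 'b::topological_space"
  assumes "prob_space P" and "independent_random_vectors P X Y"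
    and meas[measurable]: "Measurable.pred (borel \<Otimes>\<^sub>M borel) (\<lambda>z. Q (fst z) (snd z))"
    and AE: "\<And>y. AE \<omega> in P. Q (X \<omega>) y"
  shows "AE \<omega> in P. Q (X \<omega>) (Y \<omega>)"
proof -
  interpret prob_space P by fact
  have X[measurable]: "X \<in> borel_measurable P" and Y[measurable]: "Y \<in> borel_measurable P"
    and indep: "indep_set {X -` A \<inter> space P | A. A \<in> sets borel} {Y -` B \<inter> space P | B. B \<in> sets borel}"
    using assms(2) by (auto simp: independent_random_vectors_def)
  let ?D = "distr P borel X" and ?E = "distr P borel Y"
  interpret D: prob_space ?D by (rule prob_space_distr) simp
  interpret E: prob_space ?E by (rule prob_space_distr) simp
  interpret pr: pair_sigma_finite ?D ?E ..
  \<comment> \<open>The product measure is determined by its values on rectangles, where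
    independence is exactly the required factorisation.\<close>
  have joint: "?D \<Otimes>\<^sub>M ?E = distr P (borel \<Otimes>\<^sub>M borel) (\<lambda>\<omega>. (X \<omega>, Y \<omega>))"
  proof (rule pair_measure_eqI)
    fix A B assume "A \<in> sets ?D" "B \<in> sets ?E"
    then have AB[measurable]: "A \<in> sets borel" "B \<in> sets borel" by auto
    have "prob ((X -` A \<inter> space P) \<inter> (Y -` B \<inter> space P)) =
        prob (X -` A \<inter> space P) * prob (Y -` B \<inter> space P)"
      by (rule indep_setD[OF indep]) (use AB in auto)
    moreover have "(\<lambda>\<omega>. (X \<omega>, Y \<omega>)) -` (A \<times> B) \<inter> space P =
        (X -` A \<inter> space P) \<inter> (Y -` B \<inter> space P)"
      by auto
    ultimately show "emeasure ?D A * emeasure ?E B =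
        emeasure (distr P (borel \<Otimes>\<^sub>M borel) (\<lambda>\<omega>. (X \<omega>, Y \<omega>))) (A \<times> B)"
      by (simp add: emeasure_distr emeasure_eq_measure ennreal_mult)
  qed (auto intro: D.sigma_finite_measure_axioms E.sigma_finite_measure_axioms)
  have sets_DE: "sets (?D \<Otimes>\<^sub>M ?E) = sets (borel \<Otimes>\<^sub>M borel)"
    by (rule sets_pair_measure_cong) auto
  have Q_sets: "{z \<in> space (?D \<Otimes>\<^sub>M ?E). Q (fst z) (snd z)} \<in> sets (?D \<Otimes>\<^sub>M ?E)"
    using meas unfolding pred_def sets_DE sets_eq_imp_space_eq[OF sets_DE] .
  have "Measurable.pred borel (\<lambda>x. Q x y)" for y
    using measurable_compose[OF _ meas, of "\<lambda>x. (x, y)" borel] by simp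
  then have "AE x in ?D. Q x y" for y
    using AE[of y] by (subst AE_distr_iff) (auto simp: pred_def)
  then have "AE x in ?D. AE y in ?E. Q x y"
    by (subst pr.AE_commute[OF Q_sets]) simp
  then have "AE z in ?D \<Otimes>\<^sub>M ?E. Q (fst z) (snd z)"
    by (subst (asm) pr.AE_pair_iff[OF Q_sets])
  then show ?thesis
    unfolding joint by (subst (asm) AE_distr_iff) auto
qed

lemma borel_measurable_nth2:
  "(\<lambda>A :: real ^ 'n::finite ^ 'm::finite. A $ i $ j) \<in> borel_measurable borel"
  by (intro borel_measurable_continuous_onI continuous_intros)

text \<open>For a fixed signal not supported in \<open>T\<close>, its coefficient vector and the
  unit vectors of \<open>T\<close> are independent and number at most the rows of
  \<open>\<Phi>\<close>. A coincidence of images would be a linear relation between their images.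
  Conditioning on the signal then handles random \<open>\<theta>\<close>.\<close>

lemma AE_iid_gaussian_image_not_in_column_span:
  fixes \<Phi> :: "'w \<Rightarrow> real ^ 'n::finite ^ 'm::finite" and \<Psi> :: "real ^ 'n ^ 'n"
  assumes "prob_space P" "iid_gaussian_matrix P \<Phi>" "orthogonal_matrix \<Psi>" "card T < CARD('m)"
    and indep: "independent_random_vectors P \<Phi> (\<lambda>\<omega>. \<Psi> *v \<theta> \<omega>)"
  shows "AE \<omega> in P. \<not> support (\<theta> \<omega>) \<subseteq> T \<longrightarrow>
    (\<forall>w. support w \<subseteq> T \<longrightarrow> (\<Phi> \<omega> ** \<Psi>) *v w \<noteq> (\<Phi> \<omega> ** \<Psi>) *v \<theta> \<omega>)"
proof -
  obtain e :: "'n \<Rightarrow> 'm" where e: "inj_on e T"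
    using card_le_inj[of T "UNIV :: 'm set"] assms(4) by auto
  have "card (e ` T) < CARD('m)"
    using assms(4) card_image_le[of T e] by simp
  then obtain l0 where l0: "l0 \<notin> e ` T"
    by (metis UNIV_I less_irrefl subsetI subset_antisym top_greatest)
  let ?R = "insert l0 (e ` T)"
  let ?E = "embedding_matrix e T"
  \<comment> \<open>The spare index \<open>l0\<close> carries the signal as an additional column; the padded determinant
    then makes the exceptional set of pairs (matrix, signal) measurable, as Fubini requires.\<close>
  define V where "V x = \<Psi> ** ?E + (\<chi> j l. if l = l0 then x $ j else 0)" for x
  have V_mult: "V x *v u = \<Psi> *v (?E *v u) + u $ l0 *s x" for x u
  proof -
    have "(\<chi> j l. if l = l0 then x $ j else 0) *v u = u $ l0 *s x"
      by (simp add: vec_eq_iff matrix_vector_mult_def if_distrib[of "\<lambda>c. c * _"] cong: if_cong)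
    then show ?thesis
      by (simp add: V_def matrix_vector_mult_add_rdistrib matrix_vector_mul_assoc)
  qed
  \<comment> \<open>By orthogonality \<open>x v* \<Psi>\<close> is the coefficient vector of
    \<open>x\<close>. The first alternative disposes of signals supported in \<open>T\<close>, for
    which the columns of \<open>V x\<close> in \<open>?R\<close> are dependent.\<close>
  define Q where "Q A x \<longleftrightarrow>
    (\<forall>j\<in>- T. (x v* \<Psi>) $ j = 0) \<or> det (pad_columns ?R (A ** V x)) \<noteq> 0" for A :: "real ^ 'n ^ 'm" and x
  have \<Psi>_inv: "(\<Psi> *v x) v* \<Psi> = x" "\<Psi> *v (x v* \<Psi>) = x" for x
    using assms(3) by (simp_all only: transpose_matrix_vector[symmetric] matrix_vector_mul_assoc
        orthogonal_matrix_def matrix_vector_mul_lid)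
  have "AE \<omega> in P. Q (\<Phi> \<omega>) (\<Psi> *v \<theta> \<omega>)"
  proof (rule AE_independent_random_vectors[OF assms(1) indep])
    have [measurable]: "(\<lambda>z :: (real ^ 'n ^ 'm) \<times> (real ^ 'n). fst z $ i $ j) \<in> borel_measurable (borel \<Otimes>\<^sub>M borel)" for i j
      by (rule measurable_compose[OF measurable_fst borel_measurable_nth2])
    have [measurable]: "(\<lambda>z :: (real ^ 'n ^ 'm) \<times> (real ^ 'n). snd z $ j) \<in> borel_measurable (borel \<Otimes>\<^sub>M borel)" for j
      by (rule measurable_compose[OF measurable_snd])
        (intro borel_measurable_continuous_onI continuous_intros)
    have [measurable]: "(\<lambda>z :: (real ^ 'n ^ 'm) \<times> (real ^ 'n). det (pad_columns ?R (fst z ** V (snd z)))) \<in> borel_measurable (borel \<Otimes>\<^sub>M borel)"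
      by (rule borel_measurable_det_pad_columns) (simp add: matrix_matrix_mult_def V_def)
    show "Measurable.pred (borel \<Otimes>\<^sub>M borel) (\<lambda>z. Q (fst z) (snd z))"
      unfolding Q_def by (simp add: vector_matrix_mult_def)
  next
    fix x
    let ?\<theta> = "x v* \<Psi>"
    show "AE \<omega> in P. Q (\<Phi> \<omega>) x"
    proof (cases "\<forall>j\<in>- T. ?\<theta> $ j = 0")
      case False
      then obtain j where j: "j \<notin> T" "?\<theta> $ j \<noteq> 0" by auto
      have "AE \<omega> in P. det (pad_columns ?R (\<Phi> \<omega> ** V x)) \<noteq> 0"
        using assms(1,2)
      proof (rule AE_iid_gaussian_det_pad_columns_nonzero)
        fix u assume u: "support u \<subseteq> ?R" "V x *v u = 0"
        have "\<Psi> *v (?E *v u + u $ l0 *s ?\<theta>) = 0"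
          using u(2) by (simp add: V_mult matrix_vector_right_distrib vec.scale \<Psi>_inv)
        then have 0: "?E *v u + u $ l0 *s ?\<theta> = 0"
          by (rule orthogonal_matrix_mult_eq_0D[OF assms(3)])
        \<comment> \<open>Coordinate \<open>j\<close> lies outside \<open>T\<close>, where the
          embedded part vanishes; it isolates the coefficient of the signal.\<close>
        then have "(?E *v u + u $ l0 *s ?\<theta>) $ j = 0" by simp
        with j have "u $ l0 = 0"
          by (simp add: embedding_matrix_mult_nth)
        with 0 u(1) show "u = 0"
          by (intro embedding_matrix_ker_trivial[of u e T]) (auto simp: support_def)
      qed
      then show ?thesis by (simp add: Q_def)
    qed (simp add: Q_def)
  qed
  then show ?thesis
  proof (rule eventually_mono, intro allI impI notI)
    fix \<omega> w
    assume "Q (\<Phi> \<omega>) (\<Psi> *v \<theta> \<omega>)" "\<not> support (\<theta> \<omega>) \<subseteq> T"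
    then have det: "det (pad_columns ?R (\<Phi> \<omega> ** V (\<Psi> *v \<theta> \<omega>))) \<noteq> 0"
      by (auto simp: Q_def \<Psi>_inv support_def)
    assume w: "support w \<subseteq> T" "(\<Phi> \<omega> ** \<Psi>) *v w = (\<Phi> \<omega> ** \<Psi>) *v \<theta> \<omega>"
    obtain u where u: "support u \<subseteq> e ` T" "?E *v u = w"
      using embedding_matrix_onto_support[OF e w(1)] .
    \<comment> \<open>The embedding kills the spare unit vector. Subtracting it from
      \<open>u\<close> thus keeps \<open>w\<close> and gives the signal coefficient -1, so the new
      vector encodes the difference between \<open>w\<close> and \<open>\<theta> \<omega>\<close>
      and is nonzero.\<close>
    have "?E *v axis l0 1 = 0"
      using l0 by (auto simp: vec_eq_iff embedding_matrix_mult_nth axis_def)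
    then have E_u: "?E *v (u - axis l0 1) = w"
      by (simp add: u(2) matrix_vector_mult_diff_distrib)
    have l0_u: "(u - axis l0 1) $ l0 = - 1"
      using u(1) l0 by (auto simp: support_def)
    have "V (\<Psi> *v \<theta> \<omega>) *v (u - axis l0 1) = \<Psi> *v w - \<Psi> *v \<theta> \<omega>"
      unfolding V_mult E_u l0_u by simp
    then have "(\<Phi> \<omega> ** V (\<Psi> *v \<theta> \<omega>)) *v (u - axis l0 1) = 0"
      using w(2) by (simp only: matrix_vector_mul_assoc[symmetric])
        (simp add: matrix_vector_mult_diff_distrib)
    moreover have "support (u - axis l0 1) \<subseteq> ?R"
      using u(1) by (auto simp: support_def axis_def)
    ultimately have "u - axis l0 1 = 0"
      using det det_pad_columns_imp_ker_trivial by blast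
    with l0_u show False by simp
  qed
qed

section \<open>Assembling the three claims\<close>

lemma support_diff_subset: "support (v - w) \<subseteq> support v \<union> support w"
  by (auto simp: support_def)

theorem theorem1:
  fixes \<Psi> :: "real ^ 'n::finite ^ 'n" and K :: nat
  assumes "orthogonal_matrix \<Psi>" and "1 \<le> K" and "K < CARD('n)"
  shows
    "(\<forall>(P :: 'w measure) (\<Phi> :: 'w \<Rightarrow> real ^ 'n ^ 'm::finite).
        prob_space P \<and> iid_gaussian_matrix P \<Phi> \<and> 2 * K \<le> CARD('m) \<longrightarrow>
        (AE \<omega> in P. \<forall>\<theta>. l0_norm \<theta> = K \<longrightarrow>
           unique_l0_solution (\<Phi> \<omega> ** \<Psi>) (\<Phi> \<omega> *v (\<Psi> *v \<theta>)) \<theta>)) \<and>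
     (\<forall>(P :: 'w measure) (\<Phi> :: 'w \<Rightarrow> real ^ 'n ^ 'm) (\<theta> :: 'w \<Rightarrow> real ^ 'n).
        prob_space P \<and> iid_gaussian_matrix P \<Phi> \<and> K + 1 \<le> CARD('m) \<and>
        (\<forall>\<omega>\<in>space P. l0_norm (\<theta> \<omega>) = K) \<and>
        independent_random_vectors P \<Phi> (\<lambda>\<omega>. \<Psi> *v \<theta> \<omega>) \<longrightarrow>
        (AE \<omega> in P. unique_l0_solution (\<Phi> \<omega> ** \<Psi>) (\<Phi> \<omega> *v (\<Psi> *v \<theta> \<omega>)) (\<theta> \<omega>))) \<and>
     (\<forall>(\<Phi> :: real ^ 'n ^ 'm) \<theta>.
        CARD('m) \<le> K \<and> l0_norm \<theta> = K \<and>
        \<not> (CARD('m) = K \<and>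
           (\<exists>\<Omega>. {S. card S = K \<and> independent_columns (\<Phi> ** \<Psi>) S} = {\<Omega>} \<and> support \<theta> = \<Omega>)) \<longrightarrow>
        (\<exists>\<theta>'. \<theta>' \<noteq> \<theta> \<and> l0_norm \<theta>' \<le> K \<and> (\<Phi> ** \<Psi>) *v \<theta>' = \<Phi> *v (\<Psi> *v \<theta>)))"
proof (intro conjI allI impI; (elim conjE)?)
  fix P :: "'w measure" and \<Phi> :: "'w \<Rightarrow> real ^ 'n ^ 'm"
  assume P: "prob_space P" and \<Phi>: "iid_gaussian_matrix P \<Phi>"
  \<comment> \<open>There are only finitely many index sets, so one null set serves all of them and
    hence all vectors simultaneously.\<close>
  have small: "AE \<omega> in P. \<forall>T\<in>{T. card T \<le> CARD('m)}. \<forall>z. support z \<subseteq> T \<longrightarrow>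
      (\<Phi> \<omega> ** \<Psi>) *v z = 0 \<longrightarrow> z = 0"
    by (intro AE_finite_allI) (auto intro: AE_iid_gaussian_ker_trivial[OF P \<Phi> assms(1)])
  {
    assume m: "2 * K \<le> CARD('m)"
    from small show "AE \<omega> in P. \<forall>\<theta>. l0_norm \<theta> = K \<longrightarrow>
           unique_l0_solution (\<Phi> \<omega> ** \<Psi>) (\<Phi> \<omega> *v (\<Psi> *v \<theta>)) \<theta>"
    proof (rule eventually_mono, intro allI impI unique_l0_solutionI)
      fix \<omega> \<theta> w
      assume inj: "\<forall>T\<in>{T. card T \<le> CARD('m)}. \<forall>z. support z \<subseteq> T \<longrightarrow>
          (\<Phi> \<omega> ** \<Psi>) *v z = 0 \<longrightarrow> z = 0"
        and K: "l0_norm \<theta> = K"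
        and w: "l0_norm w \<le> l0_norm \<theta>" "(\<Phi> \<omega> ** \<Psi>) *v w = \<Phi> \<omega> *v (\<Psi> *v \<theta>)"
      have "card (support w \<union> support \<theta>) \<le> CARD('m)"
        using card_Un_le[of "support w" "support \<theta>"] K w(1) m by (simp add: l0_norm_def)
      moreover have "(\<Phi> \<omega> ** \<Psi>) *v (w - \<theta>) = 0"
        using w(2) by (simp add: matrix_vector_mult_diff_distrib matrix_vector_mul_assoc)
      ultimately have "w - \<theta> = 0"
        using inj support_diff_subset by blast
      then show "w = \<theta>" by simp
    qed (simp add: matrix_vector_mul_assoc)
  }
  {
    fix \<theta> :: "'w \<Rightarrow> real ^ 'n"
    assume m: "K + 1 \<le> CARD('m)" and K: "\<forall>\<omega>\<in>space P. l0_norm (\<theta> \<omega>) = K"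
      and indep: "independent_random_vectors P \<Phi> (\<lambda>\<omega>. \<Psi> *v \<theta> \<omega>)"
    have "AE \<omega> in P. \<forall>T\<in>{T. card T < CARD('m)}. \<not> support (\<theta> \<omega>) \<subseteq> T \<longrightarrow>
        (\<forall>w. support w \<subseteq> T \<longrightarrow> (\<Phi> \<omega> ** \<Psi>) *v w \<noteq> (\<Phi> \<omega> ** \<Psi>) *v \<theta> \<omega>)"
      by (intro AE_finite_allI)
        (auto intro: AE_iid_gaussian_image_not_in_column_span[OF P \<Phi> assms(1) _ indep])
    with small AE_space
    show "AE \<omega> in P. unique_l0_solution (\<Phi> \<omega> ** \<Psi>) (\<Phi> \<omega> *v (\<Psi> *v \<theta> \<omega>)) (\<theta> \<omega>)"
    proof eventually_elim
      case (elim \<omega>)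
      show ?case
      proof (rule unique_l0_solutionI)
        fix w
        assume w: "l0_norm w \<le> l0_norm (\<theta> \<omega>)" "(\<Phi> \<omega> ** \<Psi>) *v w = \<Phi> \<omega> *v (\<Psi> *v \<theta> \<omega>)"
        have card_w: "card (support w) < CARD('m)"
          using w(1) K elim(2) m by (simp add: l0_norm_def)
        have img: "(\<Phi> \<omega> ** \<Psi>) *v w = (\<Phi> \<omega> ** \<Psi>) *v \<theta> \<omega>"
          using w(2) by (simp add: matrix_vector_mul_assoc)
        \<comment> \<open>The choice \<open>T = support w\<close> excludes any competitor whose
          support misses part of that of the signal. For the remaining ones the difference is
          supported in fewer indices than there are rows, and injectivity applies.\<close>
        then have "support (\<theta> \<omega>) \<subseteq> support w"
          using elim(3) card_w by blast
        then have "support (w - \<theta> \<omega>) \<subseteq> support w"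
          using support_diff_subset[of w "\<theta> \<omega>"] by blast
        moreover have "(\<Phi> \<omega> ** \<Psi>) *v (w - \<theta> \<omega>) = 0"
          using img by (simp add: matrix_vector_mult_diff_distrib)
        ultimately have "w - \<theta> \<omega> = 0"
          using elim(1) less_imp_le[OF card_w] by blast
        then show "w = \<theta> \<omega>" by simp
      qed (simp add: matrix_vector_mul_assoc)
    qed
  }
next
  fix \<Phi> :: "real ^ 'n ^ 'm" and \<theta>
  assume "CARD('m) \<le> K" and K: "l0_norm \<theta> = K"
    and "\<not> (CARD('m) = K \<and>
      (\<exists>\<Omega>. {S. card S = K \<and> independent_columns (\<Phi> ** \<Psi>) S} = {\<Omega>} \<and> support \<theta> = \<Omega>))"
  then obtain \<theta>' where "\<theta>' \<noteq> \<theta>" "l0_norm \<theta>' \<le> K" "(\<Phi> ** \<Psi>) *v \<theta>' = (\<Phi> ** \<Psi>) *v \<theta>"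
    using ex_other_sparse_preimage[of \<theta> "\<Phi> ** \<Psi>"] by metis
  then show "\<exists>\<theta>'. \<theta>' \<noteq> \<theta> \<and> l0_norm \<theta>' \<le> K \<and> (\<Phi> ** \<Psi>) *v \<theta>' = \<Phi> *v (\<Psi> *v \<theta>)"
    by (auto simp: matrix_vector_mul_assoc)
qed

end
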